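(* Let $U$ and $V$ be two random variables with respective distribution functions $F_U$ and $F_V$ such that there exists an $x_0\in\mathbb{R}$ with $F_U(x_0),F_V(x_0)\in(0,1)$. Furthermore, let the copula of the pair $(U,V)$ be an RMM copula with generating functions $f$ and $g$, i.e. \[C(u,v)=\max\{0,\,uv-f(u)g(v)\}.\] Then there exist random variables $X,Y,Z_1,Z_2$ such that $X,Y,Z_i$ are independent for $i=1,2$, $Z_2$ is countermonotonic to $Z_1$, and the function \[H(x,y)=C(F_U(x),F_V(y))\] is the joint distribution function of the variables $\max\{X,Z_1\}$ and $\max\{Y,Z_2\}$.
   Context: Distribution functions are $F_W(x)=\mathbb{P}[W\le x]$. Random variables $Z_1,Z_2$ with distribution functions $G_1,G_2$ are countermonotonic if $\mathbb{P}[Z_1\le x,Z_2\le y]=\max\{0,G_1(x)+G_2(y)-1\}$ for all $x,y$. A copula $C$ is a copula of $(U,V)$ if the joint distribution function of $(U,V)$ equals $C(F_U(x),F_V(y))$. An RMM (reflected maxmin) copula is a function $C(u,v)=\max\{0,uv-f(u)g(v)\}$ on $[0,1]^2$, where the generating functions $f,g:[0,1]\to[0,1]$ satisfy: (G1) $f(0)=g(0)=0$ and $f(1)=g(1)=0$; (G2) $u\mapsto f(u)+u$ and $u\mapsto g(u)+u$ are nondecreasing on $[0,1]$; (G3) $f^*(u)=f(u)/u$ and $g^*(u)=g(u)/u$ are nonincreasing on $(0,1]$.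
   Formalization: The random variables X, Y, Z_1, Z_2 are allowed to take extended real values (in particular −∞); with real values the claim fails, e.g. for independent standard normal U, V and f=g=0. *)

theory Defs
  imports "HOL-Probability.Probability"
begin

definition dist_fun :: "'a measure \<Rightarrow> ('a \<Rightarrow> 'b::linorder) \<Rightarrow> 'b \<Rightarrow> real" where
  "dist_fun M W x = measure M {\<omega> \<in> space M. W \<omega> \<le> x}"

definition joint_dist_fun ::
  "'a measure \<Rightarrow> ('a \<Rightarrow> 'b::linorder) \<Rightarrow> ('a \<Rightarrow> 'c::linorder) \<Rightarrow> 'b \<Rightarrow> 'c \<Rightarrow> real" where
  "joint_dist_fun M W1 W2 x y = measure M {\<omega> \<in> space M. W1 \<omega> \<le> x \<and> W2 \<omega> \<le> y}"

definition countermonotonic ::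
  "'a measure \<Rightarrow> ('a \<Rightarrow> 'b::linorder) \<Rightarrow> ('a \<Rightarrow> 'c::linorder) \<Rightarrow> bool" where
  "countermonotonic M Z1 Z2 \<longleftrightarrow>
    (\<forall>x y. joint_dist_fun M Z1 Z2 x y = max 0 (dist_fun M Z1 x + dist_fun M Z2 y - 1))"

text \<open>Functions on the unit interval or unit square are total functions on the reals; their values
  outside the unit interval or square are never constrained.\<close>

definition copula :: "(real \<Rightarrow> real \<Rightarrow> real) \<Rightarrow> bool" where
  "copula C \<longleftrightarrow>
    (\<forall>u\<in>{0..1}. \<forall>v\<in>{0..1}. C u v \<in> {0..1}) \<and>
    (\<forall>u\<in>{0..1}. C u 0 = 0 \<and> C 0 u = 0 \<and> C u 1 = u \<and> C 1 u = u) \<and>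
    (\<forall>u\<in>{0..1}. \<forall>u'\<in>{0..1}. \<forall>v\<in>{0..1}. \<forall>v'\<in>{0..1}. u \<le> u' \<longrightarrow> v \<le> v' \<longrightarrow>
      C u' v' - C u v' - C u' v + C u v \<ge> 0)"

definition copula_of ::
  "(real \<Rightarrow> real \<Rightarrow> real) \<Rightarrow> 'a measure \<Rightarrow> ('a \<Rightarrow> real) \<Rightarrow> ('a \<Rightarrow> real) \<Rightarrow> bool" where
  "copula_of C M U V \<longleftrightarrow> copula C \<and>
    (\<forall>x y. joint_dist_fun M U V x y = C (dist_fun M U x) (dist_fun M V y))"

definition rmm_generator :: "(real \<Rightarrow> real) \<Rightarrow> bool" where
  "rmm_generator f \<longleftrightarrow>
    f \<in> {0..1} \<rightarrow> {0..1} \<and> f 0 = 0 \<and> f 1 = 0 \<and>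
    mono_on {0..1} (\<lambda>u. f u + u) \<and>
    antimono_on {0<..1} (\<lambda>u. f u / u)"

definition rmm :: "(real \<Rightarrow> real) \<Rightarrow> (real \<Rightarrow> real) \<Rightarrow> real \<Rightarrow> real \<Rightarrow> real" where
  "rmm f g u v = max 0 (u * v - f u * g v)"

text \<open>The variables \<open>X\<close>, \<open>Y\<close>, \<open>Z1\<close>, \<open>Z2\<close> are extended-real-valued, since they may need an atom
  at \<open>-\<infinity>\<close>. With real-valued ones the claim would fail: if \<open>U\<close> and \<open>V\<close> are independent standard
  normal (\<open>f = g = 0\<close>), then \<open>C (F\<^sub>U x) (F\<^sub>V y) > 0\<close> for all real \<open>x\<close>, \<open>y\<close>, whereas real-valued
  countermonotonic \<open>Z1\<close>, \<open>Z2\<close> satisfy \<open>P(Z1 \<le> x, Z2 \<le> y) = 0\<close> once \<open>x\<close> and \<open>y\<close> are small enough.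
  The maxima are automatically almost surely finite, because \<open>C (F\<^sub>U x) (F\<^sub>V y)\<close> is the joint
  distribution function of real variables.\<close>

definition independent3 ::
  "'a measure \<Rightarrow> ('a \<Rightarrow> ereal) \<Rightarrow> ('a \<Rightarrow> ereal) \<Rightarrow> ('a \<Rightarrow> ereal) \<Rightarrow> bool" where
  "independent3 M X Y Z \<longleftrightarrow>
    prob_space.indep_vars M (\<lambda>_. borel) (\<lambda>i. [X, Y, Z] ! i) {..<3::nat}"

end

theory Submission
  imports Defs
begin

text \<open>With \<open>\<phi> u = u + f u\<close>, \<open>\<psi> v = v + g v\<close> one has
  \<open>u v - f u g v = \<phi> u \<psi> v (u / \<phi> u + v / \<psi> v - 1)\<close>. Hence \<open>X\<close>, \<open>Y\<close>, \<open>Z1\<close>, \<open>Z2\<close> should have the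
  distribution functions \<open>\<phi> \<circ> F\<^sub>U\<close>, \<open>\<psi> \<circ> F\<^sub>V\<close>, \<open>u / \<phi> u\<close> at \<open>u = F\<^sub>U x\<close>, and \<open>v / \<psi> v\<close> at
  \<open>v = F\<^sub>V x\<close>; these are nondecreasing by (G2) and (G3). Since \<open>\<phi>\<close> may jump at \<open>0\<close> and
  \<open>0 / \<phi> 0\<close> is meaningless, both are replaced at \<open>0\<close> by their right limits, which are
  not both positive, so that the product formula survives.
  The variables are quantile transforms of three independent uniform variables \<open>T\<^sub>0, T\<^sub>1, T\<^sub>2\<close>;
  \<open>Z1\<close> uses \<open>T\<^sub>2\<close> and \<open>Z2\<close> uses \<open>1 - T\<^sub>2\<close>.\<close>

section \<open>Continuous extension of \<open>u + f u\<close> and \<open>u / (u + f u)\<close> to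
  the point 0\<close>

text \<open>For a monotone function bounded below, the infimum of the values is the right limit at
  0. Taking it as the value at 0 therefore preserves monotonicity and yields continuity on the
  closed interval.\<close>

lemma mono_on_continuous_extension_0:
  fixes p :: "real \<Rightarrow> real"
  assumes mono: "mono_on {0<..1} p" and cont: "continuous_on {0<..1} p"
    and range: "p \<in> {0<..1} \<rightarrow> {0..1}"
  obtains q where "mono_on {0..1} q" "continuous_on {0..1} q" "q \<in> {0..1} \<rightarrow> {0..1}"
    "\<And>u. u \<in> {0<..1} \<Longrightarrow> q u = p u"
proof -
  define m where "m = Inf (p ` {0<..1})"
  define q where "q u = (if u \<le> 0 then m else p u)" for u
  have bdd: "bdd_below (p ` {0<..1})"
    using range by (intro bdd_belowI[of _ 0]) (auto simp: Pi_iff)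
  have m_le: "m \<le> p u" if "u \<in> {0<..1}" for u
    unfolding m_def using bdd that by (intro cInf_lower) auto
  have m_ge: "0 \<le> m"
    unfolding m_def using range by (intro cInf_greatest) (auto simp: Pi_iff)
  have p1: "p 1 \<le> 1"
    using range by (auto simp: Pi_iff)
  have m1: "m \<le> 1"
    using m_le[of 1] p1 by simp
  have 1: "mono_on {0..1} q"
    using mono m_le by (auto simp: q_def mono_on_def)
  have 2: "q \<in> {0..1} \<rightarrow> {0..1}"
    using range m_ge m1 by (auto simp: q_def Pi_iff)
  have 3: "q u = p u" if "u \<in> {0<..1}" for u
    using that by (simp add: q_def)
  have "continuous (at u within {0..1}) q" if "u \<in> {0..1}" for u
  proof (cases "u = 0")
    case True
    show ?thesis
      unfolding continuous_within_eps_delta True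
    proof (intro allI impI)
      fix e :: real assume "0 < e"
      then have "Inf (p ` {0<..1}) < m + e" by (simp add: m_def)
      \<comment> \<open>By monotonicity the values of \<open>p\<close> on (0, \<open>w\<close>] lie
        between \<open>m\<close> and \<open>p w\<close>, so \<open>w\<close> itself serves as the
        delta.\<close>
      then obtain w where w: "w \<in> {0<..1}" "p w < m + e"
        using cInf_lessD[of "p ` {0<..1}" "m + e"] by auto
      have "dist (q x) (q 0) < e" if "x \<in> {0..1}" "dist x 0 < w" for x
      proof (cases "x = 0")
        case False
        then have x: "x \<in> {0<..1}" "x \<le> w" using that by auto
        have "p x \<le> p w" using mono w x by (auto simp: mono_on_def)
        moreover have "m \<le> p x" using m_le x by blast
        ultimately show ?thesis using w x by (simp add: q_def dist_real_def)
      qed (use \<open>0 < e\<close> in simp)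
      then show "\<exists>d>0. \<forall>x'\<in>{0..1}. dist x' 0 < d \<longrightarrow> dist (q x') (q 0) < e"
        using w by (intro exI[of _ w]) auto
    qed
  next
    case False
    then have u: "u \<in> {0<..1}" using that by auto
    have "continuous_on {0<..1} q"
      using cont by (subst continuous_on_cong[OF refl 3]) auto
    then have "continuous (at u within {0<..1}) q"
      using u by (simp add: continuous_on_eq_continuous_within)
    moreover have "at u within {0..1} = at u within {0<..1}"
      using u by (intro at_within_nhd[of _ "{0<..}"]) auto
    ultimately show ?thesis by (simp add: continuous_within)
  qed
  then have "continuous_on {0..1} q"
    by (simp add: continuous_on_eq_continuous_within)
  with 1 2 3 that show thesis by blast
qed

text \<open>Continuity of \<open>f\<close> on (0, 1] is not assumed but follows from the growth
  conditions: (G2) makes \<open>u + f u\<close> nondecreasing, while (G3) makes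
  \<open>(u + f u) / u\<close> nonincreasing and so excludes upward jumps. The last equation is what
  remains at 0 of the identity \<open>q u * r u = u\<close>.\<close>

lemma rmm_generator_extensions:
  assumes f: "rmm_generator f"
  obtains q r where
    "mono_on {0..1} q" "continuous_on {0..1} q" "q \<in> {0..1} \<rightarrow> {0..1}"
    "mono_on {0..1} r" "continuous_on {0..1} r" "r \<in> {0..1} \<rightarrow> {0..1}"
    "\<And>u. u \<in> {0<..1} \<Longrightarrow> q u = u + f u" "\<And>u. u \<in> {0<..1} \<Longrightarrow> r u = u / (u + f u)"
    "q 0 * r 0 = 0"
proof -
  define p where "p u = u + f u" for u
  have f0: "f u \<ge> 0" if "u \<in> {0..1}" for u
    using f that by (auto simp: rmm_generator_def Pi_iff)
  have f1: "f 1 = 0" using f by (simp add: rmm_generator_def)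
  have p_mono: "mono_on {0..1} p"
    using f unfolding rmm_generator_def p_def by (simp add: add.commute)
  have p_ge: "u \<le> p u" if "u \<in> {0..1}" for u
    using f0[OF that] by (simp add: p_def)
  have p_le: "p u \<le> 1" if "u \<in> {0..1}" for u
    using mono_onD[OF p_mono that, of 1] that f1 by (auto simp: p_def)
  \<comment> \<open>This is (G3) for \<open>p u / u = 1 + f u / u\<close>, with the denominators
    cleared.\<close>
  have star: "p v * u \<le> p u * v" if "0 < u" "u \<le> v" "v \<le> 1" for u v
  proof -
    have "f v / v \<le> f u / u"
      using f that by (auto simp: rmm_generator_def monotone_on_def)
    then show ?thesis using that by (simp add: p_def field_simps)
  qed
  \<comment> \<open>Subtracting \<open>p u * u\<close> from both sides of \<open>star\<close> bounds
    the increment of \<open>p\<close>; with \<open>p u \<le> 1\<close> this gives the Lipschitz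
    constant \<open>1 / a\<close> on [\<open>a\<close>, 1].\<close>
  have lip: "\<bar>p v - p u\<bar> \<le> \<bar>v - u\<bar> / a"
    if "0 < a" "a \<le> u" "a \<le> v" "u \<le> 1" "v \<le> 1" for a u v
  proof -
    have *: "\<bar>p v - p u\<bar> \<le> \<bar>v - u\<bar> / a" if "0 < a" "a \<le> u" "u \<le> v" "v \<le> 1" for u v
    proof -
      have "p u \<le> p v" using mono_onD[OF p_mono, of u v] that by auto
      have "(p v - p u) * u \<le> p u * (v - u)"
        using star[of u v] that by (simp add: algebra_simps)
      also have "\<dots> \<le> 1 * (v - u)"
        using that p_le[of u] by (intro mult_right_mono) auto
      finally have "(p v - p u) * u \<le> v - u" by simp
      moreover have "(p v - p u) * a \<le> (p v - p u) * u"
        using that \<open>p u \<le> p v\<close> by (intro mult_left_mono) auto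
      ultimately show ?thesis
        using that \<open>p u \<le> p v\<close> by (simp add: field_simps)
    qed
    show ?thesis
      using *[of u v] *[of v u] that by (cases "u \<le> v") (auto simp: abs_minus_commute)
  qed
  have p_cont: "continuous_on {0<..1} p"
    unfolding continuous_on_iff
  proof (intro ballI allI impI)
    fix u e :: real assume u: "u \<in> {0<..1}" and e: "0 < e"
    \<comment> \<open>The bound \<open>u/2\<close> on the distance keeps \<open>v\<close> above
      \<open>u/2\<close>, where the Lipschitz constant is \<open>2/u\<close>; the bound
      \<open>e * u / 2\<close> then makes the increment smaller than \<open>e\<close>.\<close>
    have "dist (p v) (p u) < e"
      if v: "v \<in> {0<..1}" and d: "dist v u < min (u/2) (e * u / 2)" for v
    proof -
      have "u / 2 \<le> v" using d by (auto simp: dist_real_def abs_if split: if_splits)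
      then have "\<bar>p v - p u\<bar> \<le> \<bar>v - u\<bar> / (u / 2)"
        using u v by (intro lip) auto
      also have "\<dots> < e"
        using d u by (simp add: dist_real_def field_simps)
      finally show ?thesis by (simp add: dist_real_def)
    qed
    then show "\<exists>d>0. \<forall>x'\<in>{0<..1}. dist x' u < d \<longrightarrow> dist (p x') (p u) < e"
      using u e by (intro exI[of _ "min (u/2) (e * u / 2)"]) auto
  qed
  have p_mono': "mono_on {0<..1} p"
    using p_mono by (rule mono_on_subset) auto
  have p_range: "p \<in> {0<..1} \<rightarrow> {0..1}"
  proof
    fix u :: real assume "u \<in> {0<..1}"
    then show "p u \<in> {0..1}" using p_le[of u] p_ge[of u] by auto
  qed
  obtain q where q: "mono_on {0..1} q" "continuous_on {0..1} q" "q \<in> {0..1} \<rightarrow> {0..1}"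
    "\<And>u. u \<in> {0<..1} \<Longrightarrow> q u = p u"
    using mono_on_continuous_extension_0[OF p_mono' p_cont p_range] by blast
  have p_pos: "0 < p u" if "u \<in> {0<..1}" for u
    using p_ge[of u] that by auto
  have "mono_on {0<..1} (\<lambda>u. u / p u)"
  proof (rule mono_onI)
    fix u v :: real assume uv: "u \<in> {0<..1}" "v \<in> {0<..1}" "u \<le> v"
    then show "u / p u \<le> v / p v"
      using star[of u v] p_pos[of u] p_pos[of v] by (simp add: field_simps)
  qed
  moreover have "continuous_on {0<..1} (\<lambda>u. u / p u)"
    using p_pos by (intro continuous_intros p_cont) (metis less_irrefl)
  moreover have "(\<lambda>u. u / p u) \<in> {0<..1} \<rightarrow> {0..1}"
  proof
    fix u :: real assume "u \<in> {0<..1}"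
    then show "u / p u \<in> {0..1}" using p_pos[of u] p_ge[of u] by auto
  qed
  ultimately obtain r where r: "mono_on {0..1} r" "continuous_on {0..1} r" "r \<in> {0..1} \<rightarrow> {0..1}"
    "\<And>u. u \<in> {0<..1} \<Longrightarrow> r u = u / p u"
    using mono_on_continuous_extension_0 by blast
  \<comment> \<open>The function vanishes on the open interval, hence by continuity also at the
    boundary point 0.\<close>
  have "continuous_on (closure {0<..<1}) (\<lambda>u. q u * r u - u)"
    using q r by (auto intro!: continuous_intros)
  moreover have "q u * r u = u" if "u \<in> {0<..<1}" for u
    using q(4)[of u] r(4)[of u] p_pos[of u] that by simp
  ultimately have "q 0 * r 0 - 0 = 0"
    using continuous_constant_on_closure[of "{0<..<1::real}" "\<lambda>u. q u * r u - u" 0 0]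
    by simp
  then show thesis
    using that[of q r] q r by (auto simp: p_def)
qed

section \<open>Quantile transforms with values in the extended reals\<close>

text \<open>\<open>K\<close> is the distribution function of the quantile transform \<open>h\<close> on the extended reals;
  \<open>h\<close> charges \<open>\<plusminus>\<infinity>\<close> when \<open>G\<close> does not tend to \<open>0\<close> or \<open>1\<close>.\<close>

lemma ereal_quantile_exists:
  fixes G :: "real \<Rightarrow> real"
  assumes mono: "mono G" and rcont: "\<And>x. continuous (at_right x) G" and range: "\<And>x. G x \<in> {0..1}"
  obtains h :: "real \<Rightarrow> ereal" and K :: "ereal \<Rightarrow> real"
  where "h \<in> borel_measurable borel" "\<And>x. K (ereal x) = G x" "\<And>x. K x \<in> {0..1}"
    "\<And>t x. t \<le> 1 \<Longrightarrow> h t \<le> x \<longleftrightarrow> t \<le> K x"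
proof -
  define m where "m = Inf (G ` UNIV)"
  define h where "h t = Inf (ereal ` {x. t \<le> G x})" for t
  \<comment> \<open>The value \<open>m\<close>, the limit of \<open>G\<close> at -\<infinity>, is
    the mass of the atom there. At \<infinity> the value must be 1, because
    \<open>h t \<le> \<infinity>\<close> always holds; this is why the equivalence with
    \<open>t \<le> K x\<close> is restricted to \<open>t \<le> 1\<close>.\<close>
  define K where "K x = (if x = \<infinity> then 1 else if x = -\<infinity> then m else G (real_of_ereal x))" for x
  have bdd: "bdd_below (range G)"
    using range by (intro bdd_belowI[of _ 0]) auto
  have m_le: "m \<le> G x" for x
    unfolding m_def using bdd by (intro cInf_lower) auto
  have m_iff: "t \<le> m \<longleftrightarrow> (\<forall>x. t \<le> G x)" for t
    unfolding m_def using bdd by (subst le_cInf_iff) auto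
  have m0: "0 \<le> m" "m \<le> 1"
    using range m_le[of 0] m_iff[of 0] by (force, meson atLeastAtMost_iff order_trans)
  have h_real: "h t \<le> ereal a \<longleftrightarrow> t \<le> G a" for t a
  proof
    assume "t \<le> G a"
    then show "h t \<le> ereal a" unfolding h_def by (intro Inf_lower) auto
  next
    assume le: "h t \<le> ereal a"
    \<comment> \<open>It is not known beforehand that the infimum is attained, so the bound is first
      obtained strictly to the right of \<open>a\<close>; right continuity of \<open>G\<close> then
      carries it to \<open>a\<close>.\<close>
    have "t \<le> G y" if "a < y" for y
    proof -
      have "h t < ereal y" using le that by (meson ereal_less(2) le_less_trans less_ereal.simps(1))
      then obtain x where "t \<le> G x" "x < y" unfolding h_def by (auto simp: Inf_less_iff)
      then show ?thesis using mono by (meson less_imp_le monoD order_trans)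
    qed
    then have "eventually (\<lambda>y. t \<le> G y) (at_right a)"
      by (auto simp: eventually_at_filter)
    then show "t \<le> G a"
      using rcont[of a] by (intro tendsto_lowerbound) (auto simp: continuous_within)
  qed
  have h_minf: "h t \<le> -\<infinity> \<longleftrightarrow> t \<le> m" for t
  proof -
    have "h t \<le> -\<infinity> \<longleftrightarrow> (\<forall>a. h t \<le> ereal a)"
      by (metis ereal_bot ereal_infty_less_eq(2) ereal_less_eq(2) order_trans)
    then show ?thesis by (simp add: h_real m_iff)
  qed
  have "h \<in> borel_measurable borel"
  proof (rule borel_measurableI_le)
    fix y
    have "{t. h t \<le> y} = (if y = \<infinity> then UNIV else {..K y})"
      using h_minf by (cases y) (auto simp: h_real K_def)
    then show "{t \<in> space borel. h t \<le> y} \<in> sets borel"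
      by auto
  qed
  moreover have "K (ereal x) = G x" for x by (simp add: K_def)
  moreover have "K x \<in> {0..1}" for x
    using m0 range by (cases x) (auto simp: K_def)
  moreover have "h t \<le> x \<longleftrightarrow> t \<le> K x" if "t \<le> 1" for t x
    using that h_minf by (cases x) (auto simp: K_def h_real)
  ultimately show thesis using that by blast
qed

lemma dist_fun_eq_cdf:
  fixes W :: "'a \<Rightarrow> real"
  assumes "W \<in> borel_measurable M"
  shows "dist_fun M W = cdf (distr M borel W)"
  using assms
  by (auto simp: fun_eq_iff dist_fun_def cdf_def measure_distr intro!: arg_cong[where f = "measure M"])

text \<open>Composition with a continuous monotone \<open>q\<close> preserves the monotonicity and
  right continuity of a distribution function. Continuity of \<open>q\<close> at 0 matters where the
  distribution function is still 0 but becomes positive immediately to the right.\<close>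

lemma ereal_quantile_comp_dist_fun:
  fixes W :: "'a \<Rightarrow> real"
  assumes "prob_space M" and W: "W \<in> borel_measurable M"
    and q: "mono_on {0..1} q" "continuous_on {0..1} q" "q \<in> {0..1} \<rightarrow> {0..1}"
  obtains h :: "real \<Rightarrow> ereal" and K :: "ereal \<Rightarrow> real"
  where "h \<in> borel_measurable borel" "\<And>x. K (ereal x) = q (dist_fun M W x)" "\<And>x. K x \<in> {0..1}"
    "\<And>t x. t \<le> 1 \<Longrightarrow> h t \<le> x \<longleftrightarrow> t \<le> K x"
proof -
  interpret prob_space M by fact
  interpret D: real_distribution "distr M borel W"
    using W by (rule real_distribution_distr)
  let ?F = "dist_fun M W"
  have F: "?F = cdf (distr M borel W)" using W by (rule dist_fun_eq_cdf)
  have F01: "?F x \<in> {0..1}" for x by (simp add: dist_fun_def)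
  have "mono (\<lambda>x. q (?F x))"
    using F01 D.cdf_nondecreasing by (intro monoI mono_onD[OF q(1)]) (auto simp: F)
  moreover have "continuous (at_right x) (\<lambda>x. q (?F x))" for x
  proof -
    have "(?F \<longlongrightarrow> ?F x) (at_right x)"
      using D.cdf_is_right_cont[of x] by (simp add: F continuous_within)
    then show ?thesis
      unfolding continuous_within
      using F01 by (intro continuous_on_tendsto_compose[OF q(2)]) auto
  qed
  moreover have "q (?F x) \<in> {0..1}" for x
    using q(3) F01 by blast
  ultimately show thesis
    using ereal_quantile_exists[of "\<lambda>x. q (?F x)"] that by blast
qed

section \<open>Independent uniform coordinates\<close>

lemma prob_space_uniform_01: "prob_space (restrict_space lborel {0..1::real})"
  by (rule prob_spaceI) (simp add: space_restrict_space emeasure_restrict_space)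

text \<open>Independence means that the joint law is the product of the marginal laws. Here the
  joint law is the product measure itself, since restriction to \<open>I\<close> is the identity on
  its space, and the marginals are its factors.\<close>

lemma indep_vars_PiM_coordinates:
  assumes "\<And>i. i \<in> I \<Longrightarrow> prob_space (M i)" and "I \<noteq> {}"
  shows "prob_space.indep_vars (PiM I M) M (\<lambda>i \<omega>. \<omega> i) I"
proof -
  interpret prob_space "PiM I M" using assms by (intro prob_space_PiM)
  have "distr (PiM I M) (PiM I M) (\<lambda>\<omega>. \<lambda>i\<in>I. \<omega> i) = distr (PiM I M) (PiM I M) (\<lambda>\<omega>. \<omega>)"
    by (rule distr_cong) (auto simp: space_PiM PiE_restrict)
  also have "\<dots> = PiM I (\<lambda>i. distr (PiM I M) (M i) (\<lambda>\<omega>. \<omega> i))"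
    using assms by (auto simp: distr_PiM_component intro!: PiM_cong)
  finally show ?thesis
    using assms by (subst indep_vars_iff_distr_eq_PiM') auto
qed

section \<open>The product formula and the construction of the variables\<close>

text \<open>Positivity of \<open>u\<close> and \<open>v\<close> makes both denominators positive, so
  the prefactor can be moved inside the maximum and the fractions cancelled.\<close>

lemma rmm_eq_product:
  assumes "rmm_generator f" "rmm_generator g" "u \<in> {0<..1}" "v \<in> {0<..1}"
  shows "rmm f g u v = (u + f u) * (v + g v) * max 0 (u / (u + f u) + v / (v + g v) - 1)"
proof -
  have pos: "0 < u + f u" "0 < v + g v"
    using assms by (auto simp: rmm_generator_def Pi_iff intro!: add_pos_nonneg)
  have expand: "a * b * (u / a + v / b - 1) = u * b + v * a - a * b" if "0 < a" "0 < b" for a b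
    using that by (simp add: field_simps)
  have "(u + f u) * (v + g v) * max 0 (u / (u + f u) + v / (v + g v) - 1)
      = max 0 ((u + f u) * (v + g v) * (u / (u + f u) + v / (v + g v) - 1))"
    using pos by (simp add: max_mult_distrib_left)
  also have "(u + f u) * (v + g v) * (u / (u + f u) + v / (v + g v) - 1) = u * v - f u * g v"
    unfolding expand[OF pos] by (simp add: algebra_simps)
  finally show ?thesis by (simp add: rmm_def)
qed

theorem theorem6:
  fixes M :: "'a measure" and U V :: "'a \<Rightarrow> real" and f g :: "real \<Rightarrow> real"
  assumes "prob_space M"
    and "U \<in> borel_measurable M" and "V \<in> borel_measurable M"
    and "\<exists>x0::real. dist_fun M U x0 \<in> {0<..<1} \<and> dist_fun M V x0 \<in> {0<..<1}"
    and "rmm_generator f" and "rmm_generator g"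
    and "copula_of (rmm f g) M U V"
  shows "\<exists>(N :: (nat \<Rightarrow> real) measure) (X :: (nat \<Rightarrow> real) \<Rightarrow> ereal) Y Z1 Z2.
    prob_space N \<and>
    independent3 N X Y Z1 \<and> independent3 N X Y Z2 \<and>
    countermonotonic N Z1 Z2 \<and>
    (\<forall>x y :: real.
      joint_dist_fun N (\<lambda>\<omega>. max (X \<omega>) (Z1 \<omega>)) (\<lambda>\<omega>. max (Y \<omega>) (Z2 \<omega>)) (ereal x) (ereal y)
        = rmm f g (dist_fun M U x) (dist_fun M V y))"
proof -
  obtain q1 r1 where e1:
    "mono_on {0..1} q1" "continuous_on {0..1} q1" "q1 \<in> {0..1} \<rightarrow> {0..1}"
    "mono_on {0..1} r1" "continuous_on {0..1} r1" "r1 \<in> {0..1} \<rightarrow> {0..1}"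
    "\<And>u. u \<in> {0<..1} \<Longrightarrow> q1 u = u + f u" "\<And>u. u \<in> {0<..1} \<Longrightarrow> r1 u = u / (u + f u)"
    "q1 0 * r1 0 = 0"
    using rmm_generator_extensions[OF assms(5)] by blast
  obtain q2 r2 where e2:
    "mono_on {0..1} q2" "continuous_on {0..1} q2" "q2 \<in> {0..1} \<rightarrow> {0..1}"
    "mono_on {0..1} r2" "continuous_on {0..1} r2" "r2 \<in> {0..1} \<rightarrow> {0..1}"
    "\<And>u. u \<in> {0<..1} \<Longrightarrow> q2 u = u + g u" "\<And>u. u \<in> {0<..1} \<Longrightarrow> r2 u = u / (u + g u)"
    "q2 0 * r2 0 = 0"
    using rmm_generator_extensions[OF assms(6)] by blast
  obtain hX KX where X: "hX \<in> borel_measurable borel"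
    "\<And>x. KX (ereal x) = q1 (dist_fun M U x)" "\<And>x. KX x \<in> {0..1}"
    "\<And>t x. t \<le> 1 \<Longrightarrow> hX t \<le> x \<longleftrightarrow> t \<le> KX x"
    using ereal_quantile_comp_dist_fun[OF assms(1,2) e1(1-3)] by blast
  obtain hY KY where Y: "hY \<in> borel_measurable borel"
    "\<And>x. KY (ereal x) = q2 (dist_fun M V x)" "\<And>x. KY x \<in> {0..1}"
    "\<And>t x. t \<le> 1 \<Longrightarrow> hY t \<le> x \<longleftrightarrow> t \<le> KY x"
    using ereal_quantile_comp_dist_fun[OF assms(1,3) e2(1-3)] by blast
  obtain h1 K1 where Z1: "h1 \<in> borel_measurable borel"
    "\<And>x. K1 (ereal x) = r1 (dist_fun M U x)" "\<And>x. K1 x \<in> {0..1}"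
    "\<And>t x. t \<le> 1 \<Longrightarrow> h1 t \<le> x \<longleftrightarrow> t \<le> K1 x"
    using ereal_quantile_comp_dist_fun[OF assms(1,2) e1(4-6)] by blast
  obtain h2 K2 where Z2: "h2 \<in> borel_measurable borel"
    "\<And>x. K2 (ereal x) = r2 (dist_fun M V x)" "\<And>x. K2 x \<in> {0..1}"
    "\<And>t x. t \<le> 1 \<Longrightarrow> h2 t \<le> x \<longleftrightarrow> t \<le> K2 x"
    using ereal_quantile_comp_dist_fun[OF assms(1,3) e2(4-6)] by blast
  \<comment> \<open>The coordinates 0, 1, 2 of \<open>N\<close> are the three independent uniform
    variables.\<close>
  define \<mu> where "\<mu> = restrict_space lborel {0..1::real}"
  define N where "N = PiM {..<3::nat} (\<lambda>_. \<mu>)"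
  interpret \<mu>: prob_space \<mu> unfolding \<mu>_def by (rule prob_space_uniform_01)
  interpret P: finite_product_prob_space "\<lambda>_. \<mu>" "{..<3::nat}"
    by unfold_locales auto
  interpret N: prob_space N
    unfolding N_def by (intro prob_space_PiM) unfold_locales
  have \<mu>_Icc: "{a..b} \<in> sets \<mu>" "measure \<mu> {a..b} = max 0 (b - a)"
    if "0 \<le> a" "b \<le> 1" for a b :: real
    using that by (auto simp: \<mu>_def sets_restrict_space_iff measure_restrict_space)
  \<comment> \<open>All events below confine the coordinates to intervals. The factors
    \<open>max 0\<close> cover empty intervals, and the one for coordinate 2 produces the truncation
    at 0 in the countermonotonic law and in \<open>rmm\<close>.\<close>
  have box: "measure N {\<omega> \<in> space N. A (\<omega> 0) \<and> B (\<omega> 1) \<and> C (\<omega> 2)}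
      = max 0 (b - a) * max 0 (b' - a') * max 0 (b'' - a'')"
    if "\<And>t. t \<in> {0..1} \<Longrightarrow> A t \<longleftrightarrow> t \<in> {a..b}" "\<And>t. t \<in> {0..1} \<Longrightarrow> B t \<longleftrightarrow> t \<in> {a'..b'}"
      "\<And>t. t \<in> {0..1} \<Longrightarrow> C t \<longleftrightarrow> t \<in> {a''..b''}"
      "0 \<le> a" "b \<le> 1" "0 \<le> a'" "b' \<le> 1" "0 \<le> a''" "b'' \<le> 1"
    for A B C :: "real \<Rightarrow> bool" and a b a' b' a'' b''
  proof -
    let ?S = "\<lambda>i. [{a..b}, {a'..b'}, {a''..b''}] ! i"
    have three: "{..<3} = {0, 1, 2::nat}" by auto
    have "{\<omega> \<in> space N. A (\<omega> 0) \<and> B (\<omega> 1) \<and> C (\<omega> 2)} = (\<Pi>\<^sub>E i\<in>{..<3}. ?S i)"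
    proof (intro set_eqI)
      fix \<omega> :: "nat \<Rightarrow> real"
      have "\<omega> \<in> space N \<longleftrightarrow>
          \<omega> \<in> extensional {..<3} \<and> \<omega> 0 \<in> {0..1} \<and> \<omega> 1 \<in> {0..1} \<and> \<omega> 2 \<in> {0..1}"
        by (auto simp: N_def space_PiM \<mu>_def space_restrict_space PiE_iff three)
      moreover have "\<omega> \<in> (\<Pi>\<^sub>E i\<in>{..<3}. ?S i) \<longleftrightarrow>
          \<omega> \<in> extensional {..<3} \<and> \<omega> 0 \<in> {a..b} \<and> \<omega> 1 \<in> {a'..b'} \<and> \<omega> 2 \<in> {a''..b''}"
        by (auto simp: PiE_iff three)
      ultimately show "\<omega> \<in> {\<omega> \<in> space N. A (\<omega> 0) \<and> B (\<omega> 1) \<and> C (\<omega> 2)} \<longleftrightarrow>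
          \<omega> \<in> (\<Pi>\<^sub>E i\<in>{..<3}. ?S i)"
        using that(1)[of "\<omega> 0"] that(2)[of "\<omega> 1"] that(3)[of "\<omega> 2"] that(4-9)
        unfolding mem_Collect_eq atLeastAtMost_iff by linarith
    qed
    also have "measure N \<dots> = (\<Prod>i\<in>{..<3}. measure \<mu> (?S i))"
      unfolding N_def using that(4-9) \<mu>_Icc(1) by (intro P.prob_times) (auto simp: three)
    also have "\<dots> = max 0 (b - a) * max 0 (b' - a') * max 0 (b'' - a'')"
      using that(4-9) by (simp add: three \<mu>_Icc(2))
    finally show ?thesis .
  qed
  define X where "X = (\<lambda>\<omega>::nat \<Rightarrow> real. hX (\<omega> 0))"
  define Y where "Y = (\<lambda>\<omega>::nat \<Rightarrow> real. hY (\<omega> 1))"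
  define W1 where "W1 = (\<lambda>\<omega>::nat \<Rightarrow> real. h1 (\<omega> 2))"
  define W2 where "W2 = (\<lambda>\<omega>::nat \<Rightarrow> real. h2 (1 - \<omega> 2))"
  \<comment> \<open>An arbitrary function of the third coordinate is allowed, so that both
    \<open>W1\<close> and the reflected \<open>W2\<close> are covered.\<close>
  have indep: "independent3 N X Y (\<lambda>\<omega>. h (\<omega> 2))" if "h \<in> borel_measurable borel" for h
  proof -
    have meas: "k \<in> borel_measurable \<mu>" if "k \<in> borel_measurable borel" for k :: "real \<Rightarrow> ereal"
      using that by (simp add: \<mu>_def measurable_restrict_space1)
    have three: "i = 0 \<or> i = 1 \<or> i = 2" if "i < 3" for i :: nat using that by auto
    have "N.indep_vars (\<lambda>_. \<mu>) (\<lambda>i \<omega>. \<omega> i) {..<3::nat}"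
      unfolding N_def
      by (rule indep_vars_PiM_coordinates) (simp_all add: \<mu>.prob_space_axioms lessThan_empty_iff)
    moreover have "[hX, hY, h] ! i \<in> borel_measurable \<mu>" if "i \<in> {..<3}" for i
      using three[of i] that meas[OF X(1)] meas[OF Y(1)] meas[OF \<open>h \<in> _\<close>] by auto
    ultimately have "N.indep_vars (\<lambda>_. borel) (\<lambda>i \<omega>. ([hX, hY, h] ! i) (\<omega> i)) {..<3::nat}"
      by (rule N.indep_vars_compose2)
    moreover have "N.indep_vars (\<lambda>_. borel) (\<lambda>i \<omega>. ([hX, hY, h] ! i) (\<omega> i)) {..<3::nat} \<longleftrightarrow>
        N.indep_vars (\<lambda>_. borel) (\<lambda>i. [X, Y, \<lambda>\<omega>. h (\<omega> 2)] ! i) {..<3::nat}"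
      by (rule N.indep_vars_cong) (auto simp: X_def Y_def dest!: three)
    ultimately show ?thesis by (simp add: independent3_def)
  qed
  have i1: "independent3 N X Y W1"
    unfolding W1_def using Z1(1) by (rule indep)
  have i2: "independent3 N X Y W2"
    unfolding W2_def by (rule indep[of "\<lambda>t. h2 (1 - t)"]) (use Z2(1) in measurable)
  \<comment> \<open>The reflection in \<open>W2\<close> turns an upper bound on the variable into a
    lower bound on coordinate 2. Hence \<open>W1 \<omega> \<le> x\<close> and
    \<open>W2 \<omega> \<le> y\<close> together place \<open>\<omega> 2\<close> in the interval from
    \<open>1 - K2 y\<close> to \<open>K1 x\<close>.\<close>
  have W1_iff: "W1 \<omega> \<le> x \<longleftrightarrow> \<omega> 2 \<le> K1 x" and W2_iff: "W2 \<omega> \<le> x \<longleftrightarrow> 1 - K2 x \<le> \<omega> 2"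
    and X_iff: "X \<omega> \<le> x \<longleftrightarrow> \<omega> 0 \<le> KX x" and Y_iff: "Y \<omega> \<le> x \<longleftrightarrow> \<omega> 1 \<le> KY x"
    if "\<omega> \<in> space N" for \<omega> x
  proof -
    have "\<omega> i \<in> {0..1}" if "i < 3" for i
      using that \<open>\<omega> \<in> space N\<close> by (auto simp: N_def space_PiM \<mu>_def space_restrict_space PiE_iff)
    from this[of 0] this[of 1] this[of 2]
    show "W1 \<omega> \<le> x \<longleftrightarrow> \<omega> 2 \<le> K1 x" "W2 \<omega> \<le> x \<longleftrightarrow> 1 - K2 x \<le> \<omega> 2"
      "X \<omega> \<le> x \<longleftrightarrow> \<omega> 0 \<le> KX x" "Y \<omega> \<le> x \<longleftrightarrow> \<omega> 1 \<le> KY x"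
      using X(4) Y(4) Z1(4) Z2(4) by (auto simp: W1_def W2_def X_def Y_def)
  qed
  have d1: "dist_fun N W1 x = K1 x" for x
    using box[of "\<lambda>_. True" 0 1 "\<lambda>_. True" 0 1 "\<lambda>t. t \<le> K1 x" 0 "K1 x"] Z1(3)[of x]
    by (simp add: dist_fun_def W1_iff cong: conj_cong)
  have d2: "dist_fun N W2 x = K2 x" for x
    using box[of "\<lambda>_. True" 0 1 "\<lambda>_. True" 0 1 "\<lambda>t. 1 - K2 x \<le> t" "1 - K2 x" 1] Z2(3)[of x]
    by (simp add: dist_fun_def W2_iff cong: conj_cong)
  have "joint_dist_fun N W1 W2 x y = max 0 (K1 x + K2 y - 1)" for x y
    using box[of "\<lambda>_. True" 0 1 "\<lambda>_. True" 0 1 "\<lambda>t. t \<le> K1 x \<and> 1 - K2 y \<le> t" "1 - K2 y" "K1 x"]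
      Z1(3)[of x] Z2(3)[of y]
    by (simp add: joint_dist_fun_def W1_iff W2_iff conj_commute algebra_simps cong: conj_cong)
  then have cm: "countermonotonic N W1 W2"
    by (simp add: countermonotonic_def d1 d2)
  have "joint_dist_fun N (\<lambda>\<omega>. max (X \<omega>) (W1 \<omega>)) (\<lambda>\<omega>. max (Y \<omega>) (W2 \<omega>)) (ereal x) (ereal y)
        = rmm f g (dist_fun M U x) (dist_fun M V y)" for x y
  proof -
    let ?u = "dist_fun M U x" and ?v = "dist_fun M V y"
    have u: "?u \<in> {0..1}" and v: "?v \<in> {0..1}"
      using assms(1) by (auto simp: dist_fun_def prob_space.prob_le_1)
    have "joint_dist_fun N (\<lambda>\<omega>. max (X \<omega>) (W1 \<omega>)) (\<lambda>\<omega>. max (Y \<omega>) (W2 \<omega>)) (ereal x) (ereal y)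
        = measure N {\<omega> \<in> space N. \<omega> 0 \<le> KX x \<and> \<omega> 1 \<le> KY y \<and> (1 - K2 y \<le> \<omega> 2 \<and> \<omega> 2 \<le> K1 x)}"
      unfolding joint_dist_fun_def
      by (intro arg_cong[where f = "measure N"]) (auto simp: X_iff Y_iff W1_iff W2_iff)
    also have "\<dots> = max 0 (KX x - 0) * max 0 (KY y - 0) * max 0 (K1 x - (1 - K2 y))"
      using X(3)[of x] Y(3)[of y] Z1(3)[of x] Z2(3)[of y] by (intro box) auto
    also have "\<dots> = q1 ?u * q2 ?v * max 0 (r1 ?u + r2 ?v - 1)"
      using X(3)[of x] Y(3)[of y] by (simp add: X(2) Y(2) Z1(2) Z2(2) algebra_simps)
    also have "\<dots> = rmm f g ?u ?v"
    proof -
      have r_le: "r1 ?u \<le> 1" "r2 ?v \<le> 1"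
        using e1(6) e2(6) u v by (auto simp: Pi_iff)
      have z: "f 0 = 0" "g 0 = 0" using assms(5,6) by (auto simp: rmm_generator_def)
      \<comment> \<open>If \<open>?u = 0\<close>, then \<open>rmm\<close> vanishes there because
        \<open>f 0 = 0\<close>. The product vanishes as well: either \<open>q1 0 = 0\<close>, or
        \<open>r1 0 = 0\<close> and then \<open>r2 ?v \<le> 1\<close> makes the truncated factor 0.
        The case \<open>?v = 0\<close> is symmetric.\<close>
      consider "?u = 0" | "?v = 0" | "?u \<in> {0<..1}" "?v \<in> {0<..1}"
        using u v by fastforce
      then show ?thesis
      proof cases
        case 1
        then show ?thesis using e1(9) r_le z by (auto simp: rmm_def)
      next
        case 2
        then show ?thesis using e2(9) r_le z by (auto simp: rmm_def)
      next
        case 3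
        then show ?thesis using rmm_eq_product[OF assms(5,6)] by (simp add: e1(7,8) e2(7,8))
      qed
    qed
    finally show ?thesis .
  qed
  with N.prob_space_axioms i1 i2 cm show ?thesis by blast
qed

end
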